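(* For any $0<\beta<1$ there exists a sequence $(y_n)_{n\in\mathbb N}\subseteq[0,1]$ that has $\alpha$--PPC for every $0\leqslant\alpha<\beta$, but does not have $\alpha$--PPC for any $\beta\leqslant\alpha\leqslant1$.
   Context: For $x\in\mathbb R$, $\|x\|$ is the distance from $x$ to the nearest integer. For $0\leqslant\gamma\leqslant1$, $s>0$, $N\geqslant1$: $R_2(\gamma;s,N)=\frac{1}{N^{2-\gamma}}\#\{(m,n):1\leqslant m,n\leqslant N,\ m\neq n,\ \|x_m-x_n\|\leqslant s/N^{\gamma}\}$. For $0<\gamma\leqslant1$, the sequence has $\gamma$--PPC if $\lim_{N\to\infty}R_2(\gamma;s,N)=2s$ for all $s>0$; it has $0$--PPC if $\lim_{N\to\infty}R_2(0;s,N)=2s$ for all $0<s\leqslant\frac12$. *)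

theory Defs
  imports "HOL-Analysis.Analysis"
begin

definition dist_int :: "real \<Rightarrow> real" where
  "dist_int x = \<bar>x - of_int (round x)\<bar>"

text \<open>Sequences are indexed from 1; the value at index 0 is never used.\<close>

definition R2 :: "(nat \<Rightarrow> real) \<Rightarrow> real \<Rightarrow> real \<Rightarrow> nat \<Rightarrow> real" where
  "R2 x \<gamma> s N =
     real (card {(m, n). m \<in> {1..N} \<and> n \<in> {1..N} \<and> m \<noteq> n \<and>
                         dist_int (x m - x n) \<le> s / real N powr \<gamma>})
       / real N powr (2 - \<gamma>)"

text \<open>Meaningful for \<open>0 \<le> \<gamma> \<le> 1\<close>. For \<open>\<gamma> = 0\<close> the range of \<open>s\<close> is restricted to \<open>s \<le> 1/2\<close>,
  since \<^term>\<open>dist_int\<close> never exceeds \<open>1/2\<close>.\<close>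

definition has_PPC :: "real \<Rightarrow> (nat \<Rightarrow> real) \<Rightarrow> bool" where
  "has_PPC \<gamma> x \<longleftrightarrow>
     (if \<gamma> = 0
      then \<forall>s. 0 < s \<and> s \<le> 1/2 \<longrightarrow> (\<lambda>N. R2 x 0 s N) \<longlonglongrightarrow> 2 * s
      else \<forall>s>0. (\<lambda>N. R2 x \<gamma> s N) \<longlonglongrightarrow> 2 * s)"

end

theory Submission
  imports Defs "HOL-Library.Discrete_Functions" "HOL-Real_Asymp.Real_Asymp"
begin

text \<open>
  Take the base-2 van der Corput sequence and repeat each of its points, those with index of size
  about \<open>N\<close> in the new sequence occurring about \<open>N powr (1 - \<beta>)\<close> times in a row. Each arc of length
  \<open>2r\<close> then contains \<open>2rN + O(N powr (1 - \<beta>) * (log N)\<^sup>2)\<close> of the first \<open>N\<close> points, so summing over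
  the centres counts \<open>2rN\<^sup>2\<close> pairs up to an error that is negligible against \<open>N powr (2 - \<alpha>)\<close>
  whenever \<open>\<alpha> < \<beta>\<close>. On the other hand the repetitions alone give a positive multiple of
  \<open>N powr (2 - \<beta>)\<close> pairs at distance \<open>0\<close>; for \<open>\<alpha> \<ge> \<beta>\<close> this keeps \<open>R2\<close> away from \<open>0\<close>
  uniformly in \<open>s\<close>, which contradicts the limit \<open>2s\<close> for small \<open>s\<close>.
\<close>

section \<open>Dyadic blocks of the van der Corput sequence\<close>

lemma sum_lessThan_double:
  fixes f :: "nat \<Rightarrow> 'a::comm_monoid_add"
  shows "(\<Sum>i<2 * M. f i) = (\<Sum>i<M. f (2 * i) + f (2 * i + 1))"
  by (induction M) (simp_all add: ac_simps)

text \<open>The radical inverse in base 2.\<close>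

fun vdc :: "nat \<Rightarrow> real" where
  "vdc n = (if n = 0 then 0 else (real (n mod 2) + vdc (n div 2)) / 2)"

declare vdc.simps [simp del]

lemma vdc_double: "vdc (2 * n) = vdc n / 2"
  by (cases "n = 0") (simp_all add: vdc.simps[of "2 * n"] vdc.simps[of 0])

lemma vdc_double_plus_one: "vdc (2 * n + 1) = (1 + vdc n) / 2"
  by (simp add: vdc.simps[of "Suc (2 * n)"])

lemma vdc_range: "0 \<le> vdc n \<and> vdc n < 1"
proof (induction n rule: vdc.induct)
  case (1 n)
  show ?case
  proof (cases "n = 0")
    case True
    then show ?thesis by (simp add: vdc.simps)
  next
    case False
    have "real (n mod 2) \<le> 1" by linarith
    with 1[OF False] False show ?thesis by (subst (1 2) vdc.simps) auto
  qed
qed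

lemma vdc_nonneg: "0 \<le> vdc n" and vdc_less_1: "vdc n < 1"
  using vdc_range by auto

lemma sum_block_double:
  fixes h :: "nat \<Rightarrow> real"
  shows "(\<Sum>i<2 ^ Suc q. h (a * 2 ^ Suc q + i)) =
   (\<Sum>i<2 ^ q. (h (2 * (a * 2 ^ q + i)) + h (2 * (a * 2 ^ q + i) + 1)))"
  by (simp only: power_Suc sum_lessThan_double) (simp add: algebra_simps)

text \<open>The points of indices \<open>2 * k\<close> and \<open>2 * k + 1\<close> lie in the lower
  and the upper half of the unit interval. The threshold \<open>u\<close> settles one of them
  outright, and the other compares \<open>vdc k\<close> with \<open>2 * u\<close> or
  \<open>2 * u - 1\<close>. The two terms add up to the term of \<open>k\<close> for that new
  threshold, so doubling the block length does not enlarge the bound.\<close>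

lemma vdc_block_less:
  assumes "0 \<le> u" "u \<le> 1"
  shows "\<bar>\<Sum>i<2 ^ q. (of_bool (vdc (a * 2 ^ q + i) < u) - u)\<bar> \<le> 1"
  using assms
proof (induction q arbitrary: u)
  case 0
  then show ?case by auto
next
  case (Suc q)
  let ?k = "\<lambda>i. a * 2 ^ q + i"
  have eq: "(\<Sum>i<2 ^ Suc q. (of_bool (vdc (a * 2 ^ Suc q + i) < u) - u)) =
    (\<Sum>i<2 ^ q. (of_bool (vdc (?k i) / 2 < u) - u) + (of_bool ((1 + vdc (?k i)) / 2 < u) - u))"
    unfolding sum_block_double[where h = "\<lambda>n. of_bool (vdc n < u) - u"] vdc_double vdc_double_plus_one ..
  show ?case
  proof (cases "u \<le> 1 / 2")
    case True
    have "(of_bool (vdc k / 2 < u) - u) + (of_bool ((1 + vdc k) / 2 < u) - u)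
        = of_bool (vdc k < 2 * u) - 2 * u" for k
      using True vdc_nonneg[of k] by (auto simp: of_bool_def)
    with Suc.IH[of "2 * u"] True Suc.prems show ?thesis unfolding eq by simp
  next
    case False
    have "(of_bool (vdc k / 2 < u) - u) + (of_bool ((1 + vdc k) / 2 < u) - u)
        = of_bool (vdc k < 2 * u - 1) - (2 * u - 1)" for k
      using False vdc_less_1[of k] by (auto simp: of_bool_def)
    then show ?thesis
      unfolding eq using Suc.IH[of "2 * u - 1"] False Suc.prems by (simp only:)
  qed
qed

text \<open>Same halving, but \<open>u = 1 / 2\<close> falls into the upper case, since a point
  equal to \<open>1 / 2\<close> now counts. Closed arcs call for both kinds of threshold.\<close>

lemma vdc_block_le:
  assumes "0 \<le> u" "u \<le> 1"
  shows "\<bar>\<Sum>i<2 ^ q. (of_bool (vdc (a * 2 ^ q + i) \<le> u) - u)\<bar> \<le> 1"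
  using assms
proof (induction q arbitrary: u)
  case 0
  then show ?case by auto
next
  case (Suc q)
  let ?k = "\<lambda>i. a * 2 ^ q + i"
  have eq: "(\<Sum>i<2 ^ Suc q. (of_bool (vdc (a * 2 ^ Suc q + i) \<le> u) - u)) =
    (\<Sum>i<2 ^ q. (of_bool (vdc (?k i) / 2 \<le> u) - u) + (of_bool ((1 + vdc (?k i)) / 2 \<le> u) - u))"
    unfolding sum_block_double[where h = "\<lambda>n. of_bool (vdc n \<le> u) - u"] vdc_double vdc_double_plus_one ..
  show ?case
  proof (cases "u < 1 / 2")
    case True
    have "(of_bool (vdc k / 2 \<le> u) - u) + (of_bool ((1 + vdc k) / 2 \<le> u) - u)
        = of_bool (vdc k \<le> 2 * u) - 2 * u" for k
      using True vdc_nonneg[of k] by (auto simp: of_bool_def)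
    with Suc.IH[of "2 * u"] True Suc.prems show ?thesis unfolding eq by simp
  next
    case False
    have "(of_bool (vdc k / 2 \<le> u) - u) + (of_bool ((1 + vdc k) / 2 \<le> u) - u)
        = of_bool (vdc k \<le> 2 * u - 1) - (2 * u - 1)" for k
      using False vdc_less_1[of k] by (auto simp: of_bool_def)
    then show ?thesis
      unfolding eq using Suc.IH[of "2 * u - 1"] False Suc.prems by (simp only:)
  qed
qed

section \<open>Repeated points and the resulting discrepancy\<close>

text \<open>The common property of the strict and non-strict threshold indicators minus their mean,
  so that repetitions are handled once for both.\<close>

definition vdc_balanced :: "(real \<Rightarrow> real) \<Rightarrow> bool" where
  "vdc_balanced h \<longleftrightarrow> (\<forall>a q. \<bar>\<Sum>i<2 ^ q. h (vdc (a * 2 ^ q + i))\<bar> \<le> 1)"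

text \<open>If \<open>q > 0\<close>, the indices \<open>2 * k\<close> and \<open>2 * k + 1\<close>
  have the same quotient, so one level of repetition can be traded for a factor 2. A block of length
  1 is a single term, bounded by 1.\<close>

lemma vdc_balanced_repeated_block:
  assumes "vdc_balanced h"
  shows "\<bar>\<Sum>i<2 ^ q. h (vdc ((a * 2 ^ q + i) div 2 ^ p))\<bar> \<le> 2 ^ p"
proof (induction p arbitrary: q)
  case 0
  then show ?case using assms by (simp add: vdc_balanced_def)
next
  case (Suc p)
  show ?case
  proof (cases q)
    case 0
    have "\<bar>h (vdc k)\<bar> \<le> 1" for k
      using assms[unfolded vdc_balanced_def, rule_format, where a = k and q = 0] by simp
    moreover have "(1::real) \<le> 2 ^ Suc p" by (rule one_le_power) simp
    ultimately show ?thesis using 0 order_trans by fastforce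
  next
    case (Suc r)
    have div: "(2 * k) div 2 ^ Suc p = k div 2 ^ p" "(2 * k + 1) div 2 ^ Suc p = k div 2 ^ p" for k :: nat
      by (simp_all add: div_mult2_eq)
    have "(\<Sum>i<2 ^ q. h (vdc ((a * 2 ^ q + i) div 2 ^ Suc p)))
        = 2 * (\<Sum>i<2 ^ r. h (vdc ((a * 2 ^ r + i) div 2 ^ p)))"
      unfolding Suc sum_block_double[where h = "\<lambda>n. h (vdc (n div 2 ^ Suc p))"] div
      by (simp add: sum_distrib_left)
    with Suc.IH[of r] show ?thesis by (simp add: abs_mult)
  qed
qed

text \<open>Binary splitting: an initial segment either lies in the first half of the block or
  consists of that half and an initial segment of the second. Each of the \<open>q + 1\<close>
  levels uses at most one full block, at cost \<open>2 ^ p\<close>.\<close>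

lemma vdc_balanced_repeated_initial:
  assumes "vdc_balanced h" "t \<le> 2 ^ q"
  shows "\<bar>\<Sum>i<t. h (vdc ((a * 2 ^ q + i) div 2 ^ p))\<bar> \<le> real (q + 1) * 2 ^ p"
  using assms(2)
proof (induction q arbitrary: a t)
  case 0
  then consider "t = 0" | "t = 1" by fastforce
  then show ?case
  proof cases
    case 2
    then show ?thesis using vdc_balanced_repeated_block[OF assms(1), where q = 0 and a = a and p = p] by simp
  qed simp
next
  case (Suc q)
  let ?f = "\<lambda>n. h (vdc (n div 2 ^ p))"
  show ?case
  proof (cases "t \<le> 2 ^ q")
    case True
    have "\<bar>\<Sum>i<t. ?f (2 * a * 2 ^ q + i)\<bar> \<le> real (q + 1) * 2 ^ p"
      by (rule Suc.IH[OF True])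
    also have "\<dots> \<le> real (Suc q + 1) * 2 ^ p" by simp
    finally show ?thesis by (simp add: mult_ac)
  next
    case False
    then obtain s where s: "t = 2 ^ q + s" by (metis nat_le_linear le_Suc_ex)
    have "(\<Sum>i<t. ?f (2 * a * 2 ^ q + i)) =
        (\<Sum>i<2 ^ q. ?f (2 * a * 2 ^ q + i)) + (\<Sum>i<s. ?f (2 * a * 2 ^ q + (2 ^ q + i)))"
      unfolding s by (induction s) (simp_all add: ac_simps)
    also have "(\<Sum>i<s. ?f (2 * a * 2 ^ q + (2 ^ q + i))) = (\<Sum>i<s. ?f ((2 * a + 1) * 2 ^ q + i))"
      by (simp add: algebra_simps)
    finally have "\<bar>\<Sum>i<t. ?f (2 * a * 2 ^ q + i)\<bar> \<le> 2 ^ p + real (q + 1) * 2 ^ p"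
      using vdc_balanced_repeated_block[OF assms(1), where q = q and a = "2 * a" and p = p]
        Suc.IH[of s "2 * a + 1"] Suc.prems s by simp
    then show ?thesis by (simp add: algebra_simps)
  qed
qed

text \<open>Every point with index in \<open>[2 ^ J, 2 ^ (J + 1))\<close> belongs to a run of \<open>2 ^ p J\<close> equal
  consecutive points (if \<open>p J \<le> J\<close>); keeping the run length a power of two that is constant on such
  a range makes runs and dyadic blocks nest.\<close>

definition clustered_vdc :: "(nat \<Rightarrow> nat) \<Rightarrow> nat \<Rightarrow> real" where
  "clustered_vdc p n = vdc (n div 2 ^ p (floor_log n))"

lemma clustered_vdc_stage:
  assumes "2 ^ J \<le> n" "n < 2 ^ Suc J"
  shows "clustered_vdc p n = vdc (n div 2 ^ p J)"
proof -
  have "floor_log n = J" using assms by (intro floor_log_eqI) (auto intro: less_le_trans[OF _ assms(1)])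
  then show ?thesis by (simp add: clustered_vdc_def)
qed

lemma clustered_vdc_nonneg: "0 \<le> clustered_vdc p n"
  and clustered_vdc_less_1: "clustered_vdc p n < 1"
  by (simp_all add: clustered_vdc_def vdc_nonneg vdc_less_1)

text \<open>Stage \<open>j\<close> consists of the indices in \<open>[2 ^ j, 2 ^ (j + 1))\<close>
  and costs at most \<open>(j + 1) * 2 ^ p j\<close>. By monotonicity of \<open>p\<close> every
  stage up to \<open>J\<close> is charged at the last run length, and the square bounds the sum of
  the linear factors.\<close>

lemma clustered_vdc_discrepancy:
  assumes h: "vdc_balanced h" and p: "mono p" and "N \<le> 2 ^ Suc J"
  shows "\<bar>\<Sum>n\<in>{1..<N}. h (clustered_vdc p n)\<bar> \<le> (real J + 1)\<^sup>2 * 2 ^ p J"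
  using assms(3)
proof (induction J arbitrary: N)
  case 0
  then consider "N = 0" | "N = 1" | "N = 2" by fastforce
  then show ?case
  proof cases
    case 3
    have "clustered_vdc p 1 = vdc (1 div 2 ^ p 0)" by (rule clustered_vdc_stage) auto
    moreover have "{1..<2::nat} = {1}" by auto
    ultimately show ?thesis
      using 3 vdc_balanced_repeated_block[OF h, where q = 0 and a = 1 and p = "p 0"] by simp
  qed simp_all
next
  case (Suc J)
  have mono: "(2::real) ^ p J \<le> 2 ^ p (Suc J)"
    using p by (simp add: mono_def)
  have *: "\<bar>\<Sum>n\<in>{1..<M}. h (clustered_vdc p n)\<bar> \<le> (real J + 1)\<^sup>2 * 2 ^ p (Suc J)" if "M \<le> 2 ^ Suc J" for M
    by (rule order_trans[OF Suc.IH[OF that] mult_left_mono[OF mono]]) simp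
  show ?case
  proof (cases "N \<le> 2 ^ Suc J")
    case True
    have "(real J + 1)\<^sup>2 * 2 ^ p (Suc J) \<le> (real (Suc J) + 1)\<^sup>2 * 2 ^ p (Suc J)"
      by (intro mult_right_mono power_mono) auto
    with *[OF True] show ?thesis by linarith
  next
    case False
    then obtain t where t: "N = 2 ^ Suc J + t" by (metis nat_le_linear le_Suc_ex)
    have t': "t \<le> 2 ^ Suc J" using Suc.prems t by simp
    have "(\<Sum>n\<in>{1..<N}. h (clustered_vdc p n)) =
        (\<Sum>n\<in>{1..<2 ^ Suc J}. h (clustered_vdc p n)) + (\<Sum>n\<in>{2 ^ Suc J..<N}. h (clustered_vdc p n))"
      using False by (intro sum.atLeastLessThan_concat[symmetric]) auto
    also have "(\<Sum>n\<in>{2 ^ Suc J..<N}. h (clustered_vdc p n)) = (\<Sum>i<t. h (clustered_vdc p (2 ^ Suc J + i)))"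
      unfolding t by (induction t) (simp_all add: ac_simps)
    \<comment> \<open>A stage is the dyadic block with \<open>a = 1\<close>, on which the run length
      is constant.\<close>
    also have "\<dots> = (\<Sum>i<t. h (vdc ((1 * 2 ^ Suc J + i) div 2 ^ p (Suc J))))"
      using t' by (intro sum.cong refl arg_cong[where f = h])
        (subst clustered_vdc_stage[where J = "Suc J"], auto)
    finally have "\<bar>\<Sum>n\<in>{1..<N}. h (clustered_vdc p n)\<bar> \<le>
        (real J + 1)\<^sup>2 * 2 ^ p (Suc J) + real (Suc J + 1) * 2 ^ p (Suc J)"
      using *[of "2 ^ Suc J"]
        vdc_balanced_repeated_initial[OF h t', where a = 1 and p = "p (Suc J)"] by linarith
    also have "\<dots> = ((real J + 1)\<^sup>2 + (real J + 2)) * 2 ^ p (Suc J)" by (simp add: algebra_simps)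
    also have "\<dots> \<le> (real (Suc J) + 1)\<^sup>2 * 2 ^ p (Suc J)"
      by (intro mult_right_mono) (auto simp: power2_eq_square algebra_simps)
    finally show ?thesis .
  qed
qed

section \<open>Arcs modulo 1\<close>

lemma dist_int_le_iff: "dist_int x \<le> r \<longleftrightarrow> (\<exists>k::int. \<bar>x - of_int k\<bar> \<le> r)"
proof
  assume "\<exists>k::int. \<bar>x - of_int k\<bar> \<le> r"
  then obtain k :: int where k: "\<bar>x - of_int k\<bar> \<le> r" ..
  have "\<bar>x - of_int (round x)\<bar> \<le> \<bar>x - of_int k\<bar>"
    using round_diff_minimal[of x k] by simp
  with k show "dist_int x \<le> r" by (simp add: dist_int_def)
qed (auto simp: dist_int_def)

lemma dist_int_le_iff_unit:
  assumes "\<bar>x\<bar> < 1" "r < 1"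
  shows "dist_int x \<le> r \<longleftrightarrow> \<bar>x\<bar> \<le> r \<or> \<bar>x - 1\<bar> \<le> r \<or> \<bar>x + 1\<bar> \<le> r"
proof -
  have "k = 0 \<or> k = 1 \<or> k = -1" if "\<bar>x - of_int k\<bar> \<le> r" for k :: int
  proof -
    have "real_of_int k < 2" "real_of_int k > -2" using that assms by linarith+
    then have "k < 2" "k > -2" by linarith+
    then show ?thesis by linarith
  qed
  then show ?thesis unfolding dist_int_le_iff
    by (metis add_uminus_conv_diff diff_minus_eq_add diff_zero of_int_0 of_int_1 of_int_minus)
qed

lemma dist_int_le_half: "dist_int x \<le> 1 / 2"
  using of_int_round_abs_le[of x] by (simp add: dist_int_def abs_minus_commute)

text \<open>A closed arc has an inclusive upper end (\<open>y \<le> u\<close>) and an excluded part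
  below its lower end (\<open>y < v\<close>). The constant \<open>e\<close> is 1 if the arc wraps
  around 0 or is the whole circle. The mean \<open>e + u - v\<close> is the arc length, so
  subtracting it leaves two balanced functions.\<close>

lemma arc_as_thresholds:
  assumes "0 \<le> c" "c < 1" "0 < r" "r \<le> 1 / 2"
  obtains u v e :: real where "0 \<le> u" "u \<le> 1" "0 \<le> v" "v \<le> 1" "e + u - v = 2 * r"
    "\<forall>y\<in>{0..<1}. of_bool (dist_int (c - y) \<le> r) = e + of_bool (y \<le> u) - of_bool (y < v)"
proof -
  have D: "dist_int (c - y) \<le> r \<longleftrightarrow> \<bar>c - y\<bar> \<le> r \<or> \<bar>c - y - 1\<bar> \<le> r \<or> \<bar>c - y + 1\<bar> \<le> r"
    if "0 \<le> y" "y < 1" for y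
    using assms that by (intro dist_int_le_iff_unit) auto
  \<comment> \<open>The case \<open>r = 1 / 2\<close> is separate because the two pieces of a
    wrapping arc would then share an endpoint, which would be counted twice.\<close>
  consider "r = 1 / 2" | "r < 1 / 2" "c - r < 0" | "r < 1 / 2" "c + r \<ge> 1" | "0 \<le> c - r" "c + r < 1"
    using assms by linarith
  then show thesis
  proof cases
    case 1
    show thesis by (rule that[of 1 1 1]) (simp_all add: 1 dist_int_le_half del: le_divide_eq_numeral1)
  next
    case 2
    show thesis by (rule that[of "c + r" "c - r + 1" 1]) (use 2 assms in \<open>auto simp: D of_bool_def\<close>)
  next
    case 3
    show thesis by (rule that[of "c + r - 1" "c - r" 1]) (use 3 assms in \<open>auto simp: D of_bool_def\<close>)
  next
    case 4
    show thesis by (rule that[of "c + r" "c - r" 0]) (use 4 assms in \<open>auto simp: D of_bool_def\<close>)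
  qed
qed

lemma clustered_vdc_arc_discrepancy:
  assumes "0 \<le> c" "c < 1" "0 < r" "r \<le> 1 / 2" "mono p" "N < 2 ^ Suc J"
  shows "\<bar>(\<Sum>n\<in>{1..N}. of_bool (dist_int (c - clustered_vdc p n) \<le> r)) - 2 * r * real N\<bar>
           \<le> 2 * (real J + 1)\<^sup>2 * 2 ^ p J"
proof -
  obtain u v e :: real where uv: "0 \<le> u" "u \<le> 1" "0 \<le> v" "v \<le> 1" and e: "e + u - v = 2 * r"
    and ind: "\<forall>y\<in>{0..<1}. of_bool (dist_int (c - y) \<le> r) = e + of_bool (y \<le> u) - of_bool (y < v)"
    by (rule arc_as_thresholds[OF assms(1-4)])
  let ?y = "clustered_vdc p"
  have "(\<Sum>n\<in>{1..N}. of_bool (dist_int (c - ?y n) \<le> r)) - 2 * r * real N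
      = (\<Sum>n\<in>{1..N}. of_bool (dist_int (c - ?y n) \<le> r) - 2 * r)"
    by (simp add: sum_subtractf)
  also have "\<dots> = (\<Sum>n\<in>{1..N}. (of_bool (?y n \<le> u) - u) - (of_bool (?y n < v) - v))"
    using e by (intro sum.cong refl) (simp add: ind clustered_vdc_nonneg clustered_vdc_less_1)
  \<comment> \<open>The discrepancy bound concerns half-open ranges, and
    \<open>N < 2 ^ Suc J\<close> is what admits \<open>Suc N\<close>. The two sums account for the
    factor 2.\<close>
  also have "\<dots> = (\<Sum>n\<in>{1..<Suc N}. of_bool (?y n \<le> u) - u) - (\<Sum>n\<in>{1..<Suc N}. of_bool (?y n < v) - v)"
    by (simp add: sum_subtractf atLeastLessThanSuc_atLeastAtMost)
  finally show ?thesis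
    using clustered_vdc_discrepancy[of "\<lambda>y. of_bool (y \<le> u) - u" p "Suc N" J]
      clustered_vdc_discrepancy[of "\<lambda>y. of_bool (y < v) - v" p "Suc N" J]
      vdc_block_le[OF uv(1,2)] vdc_block_less[OF uv(3,4)] assms(5,6)
    by (simp add: vdc_balanced_def)
qed

section \<open>Run lengths and pair correlations below \<beta>\<close>

lemma card_pairs_eq_sum:
  fixes D :: "nat \<Rightarrow> nat \<Rightarrow> bool"
  assumes "\<And>m. D m m"
  shows "real (card {(m, n). m \<in> {1..N} \<and> n \<in> {1..N} \<and> m \<noteq> n \<and> D m n})
       = (\<Sum>m\<in>{1..N}. (\<Sum>n\<in>{1..N}. of_bool (D m n)) - 1)"
proof -
  have "{(m, n). m \<in> {1..N} \<and> n \<in> {1..N} \<and> m \<noteq> n \<and> D m n} =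
      (SIGMA m:{1..N}. {n \<in> {1..N}. D m n} - {m})" by auto
  then have "real (card {(m, n). m \<in> {1..N} \<and> n \<in> {1..N} \<and> m \<noteq> n \<and> D m n}) =
      (\<Sum>m\<in>{1..N}. real (card ({n \<in> {1..N}. D m n} - {m})))"
    by (simp add: card_SigmaI)
  also have "\<dots> = (\<Sum>m\<in>{1..N}. (\<Sum>n\<in>{1..N}. of_bool (D m n)) - 1)"
  proof (rule sum.cong[OF refl])
    fix m assume m: "m \<in> {1..N}"
    have "card {n \<in> {1..N}. D m n} = Suc (card ({n \<in> {1..N}. D m n} - {m}))"
      using m assms by (intro card.remove) auto
    moreover have "(\<Sum>n\<in>{1..N}. of_bool (D m n)) = real (card {n \<in> {1..N}. D m n})"
      by (simp add: sum_of_bool_eq Int_def)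
    ultimately show "real (card ({n \<in> {1..N}. D m n} - {m})) = (\<Sum>n\<in>{1..N}. of_bool (D m n)) - 1"
      by simp
  qed
  finally show ?thesis .
qed

text \<open>For \<open>\<beta> < 1\<close> the floor makes \<open>2 ^ mult_exp \<beta> j\<close> the
  largest power of two not exceeding \<open>(2 ^ j) powr (1 - \<beta>)\<close>, hence within a
  factor 2 of it.\<close>

definition mult_exp :: "real \<Rightarrow> nat \<Rightarrow> nat" where
  "mult_exp \<beta> j = nat \<lfloor>(1 - \<beta>) * real j\<rfloor>"

lemma mono_mult_exp: "\<beta> < 1 \<Longrightarrow> mono (mult_exp \<beta>)"
  by (auto simp: mono_def mult_exp_def intro!: nat_mono floor_mono mult_left_mono)

lemma two_power_mult_exp_le:
  assumes "\<beta> < 1"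
  shows "(2::real) ^ mult_exp \<beta> j \<le> (2 ^ j) powr (1 - \<beta>)"
proof -
  have "real (mult_exp \<beta> j) \<le> (1 - \<beta>) * real j" using assms by (simp add: mult_exp_def)
  then have "(2::real) powr real (mult_exp \<beta> j) \<le> 2 powr ((1 - \<beta>) * real j)" by simp
  then show ?thesis by (simp add: powr_realpow[symmetric] powr_powr mult_ac)
qed

lemma two_power_mult_exp_ge:
  assumes "\<beta> < 1"
  shows "(2 ^ j) powr (1 - \<beta>) \<le> 2 * (2::real) ^ mult_exp \<beta> j"
proof -
  have "(1 - \<beta>) * real j \<le> 1 + real (mult_exp \<beta> j)" unfolding mult_exp_def by linarith
  then have "(2::real) powr ((1 - \<beta>) * real j) \<le> 2 powr (1 + real (mult_exp \<beta> j))" by simp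
  then show ?thesis by (simp add: powr_realpow[symmetric] powr_powr powr_add mult_ac)
qed

text \<open>Each of the \<open>N\<close> centres contributes the arc discrepancy plus 1 for the
  removed diagonal pair. The total is divided by \<open>N powr (2 - \<alpha>)\<close>.\<close>

lemma R2_clustered_vdc_bound:
  assumes \<beta>: "0 < \<beta>" "\<beta> < 1" and N: "N \<ge> 1" and s: "0 < s" "s / real N powr \<alpha> \<le> 1 / 2"
  shows "\<bar>R2 (clustered_vdc (mult_exp \<beta>)) \<alpha> s N - 2 * s\<bar>
      \<le> real N powr (\<alpha> - 1) * (2 * (log 2 (real N) + 1)\<^sup>2 * real N powr (1 - \<beta>) + 1)"
proof -
  define r where "r = s / real N powr \<alpha>"
  define J where "J = floor_log N"
  let ?y = "clustered_vdc (mult_exp \<beta>)"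
  have J: "2 ^ J \<le> N" "N < 2 ^ Suc J"
    using N floor_log_exp2_le[of N] floor_log_exp2_gt[of N] by (auto simp: J_def)
  have r: "0 < r" "r \<le> 1 / 2" using s N by (auto simp: r_def)
  define E where "E = 2 * (log 2 (real N) + 1)\<^sup>2 * real N powr (1 - \<beta>)"
  have J': "(2::real) ^ J \<le> real N"
    using J(1) by (metis of_nat_le_iff of_nat_numeral of_nat_power)
  have JE: "2 * (real J + 1)\<^sup>2 * 2 ^ mult_exp \<beta> J \<le> E"
  proof -
    have "log 2 (2 ^ J) \<le> log 2 (real N)"
      using J' N by (subst log_le_cancel_iff) auto
    then have 1: "real J \<le> log 2 (real N)" by (simp add: log_nat_power)
    have "(2::real) ^ mult_exp \<beta> J \<le> (2 ^ J) powr (1 - \<beta>)" by (rule two_power_mult_exp_le[OF \<beta>(2)])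
    also have "\<dots> \<le> real N powr (1 - \<beta>)" using J' \<beta> by (intro powr_mono2) auto
    finally have 2: "(2::real) ^ mult_exp \<beta> J \<le> real N powr (1 - \<beta>)" .
    show ?thesis unfolding E_def using 1 2 by (intro mult_mono power_mono) auto
  qed
  let ?S = "\<lambda>m. \<Sum>n\<in>{1..N}. of_bool (dist_int (?y m - ?y n) \<le> r) :: real"
  define C where "C = real (card {(m, n). m \<in> {1..N} \<and> n \<in> {1..N} \<and> m \<noteq> n \<and> dist_int (?y m - ?y n) \<le> r})"
  have "C = (\<Sum>m\<in>{1..N}. ?S m - 1)"
    unfolding C_def using r by (intro card_pairs_eq_sum) (simp add: dist_int_def)
  then have "C - 2 * r * (real N)\<^sup>2 = (\<Sum>m\<in>{1..N}. ?S m - 1 - 2 * r * real N)"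
    by (simp add: sum_subtractf power2_eq_square algebra_simps)
  also have "\<bar>\<dots>\<bar> \<le> (\<Sum>m\<in>{1..N}. E + 1)"
  proof (rule order_trans[OF sum_abs], rule sum_mono)
    fix m assume "m \<in> {1..N}"
    have "\<bar>?S m - 2 * r * real N\<bar> \<le> 2 * (real J + 1)\<^sup>2 * 2 ^ mult_exp \<beta> J"
      using r J mono_mult_exp \<beta> clustered_vdc_nonneg clustered_vdc_less_1
      by (intro clustered_vdc_arc_discrepancy) auto
    with JE show "\<bar>?S m - 1 - 2 * r * real N\<bar> \<le> E + 1" by linarith
  qed
  finally have *: "\<bar>C - 2 * r * (real N)\<^sup>2\<bar> \<le> real N * (E + 1)" by simp
  have P: "real N powr (2 - \<alpha>) = (real N)\<^sup>2 / real N powr \<alpha>" "real N powr (2 - \<alpha>) > 0"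
    using N by (auto simp: powr_diff powr_numeral)
  have "2 * s = 2 * r * (real N)\<^sup>2 / real N powr (2 - \<alpha>)"
    using N by (simp add: r_def P)
  then have "R2 ?y \<alpha> s N - 2 * s = (C - 2 * r * (real N)\<^sup>2) / real N powr (2 - \<alpha>)"
    by (simp add: R2_def C_def r_def diff_divide_distrib)
  also have "\<bar>\<dots>\<bar> = \<bar>C - 2 * r * (real N)\<^sup>2\<bar> / real N powr (2 - \<alpha>)" by simp
  also have "\<dots> \<le> real N * (E + 1) / real N powr (2 - \<alpha>)"
    using * P by (intro divide_right_mono) auto
  also have "\<dots> = real N powr (\<alpha> - 1) * (E + 1)"
    using N by (simp add: P powr_diff power2_eq_square field_simps)
  finally show ?thesis by (simp add: E_def)
qed

lemma R2_clustered_vdc_tendsto: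
  assumes "0 < \<beta>" "\<beta> < 1" "\<alpha> < \<beta>" "0 < s" "\<forall>\<^sub>F N in sequentially. s / real N powr \<alpha> \<le> 1 / 2"
  shows "R2 (clustered_vdc (mult_exp \<beta>)) \<alpha> s \<longlonglongrightarrow> 2 * s"
proof -
  have ev: "\<forall>\<^sub>F N in sequentially. norm (R2 (clustered_vdc (mult_exp \<beta>)) \<alpha> s N - 2 * s)
      \<le> real N powr (\<alpha> - 1) * (2 * (log 2 (real N) + 1)\<^sup>2 * real N powr (1 - \<beta>) + 1)"
    using assms(5) eventually_ge_at_top[of 1]
    by eventually_elim (use R2_clustered_vdc_bound assms in simp)
  have "\<alpha> - 1 < 0" "\<alpha> - \<beta> < 0" "1 - \<beta> > 0" using assms by auto
  \<comment> \<open>Here \<open>\<alpha> < \<beta>\<close> enters: the negative power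
    \<open>\<alpha> - \<beta>\<close> absorbs the squared logarithm.\<close>
  have "(\<lambda>N. 2 * ((log 2 (real N) + 1)\<^sup>2 * real N powr (\<alpha> - \<beta>)) + real N powr (\<alpha> - 1)) \<longlonglongrightarrow> 2 * 0 + 0"
    using \<open>\<alpha> - 1 < 0\<close> \<open>\<alpha> - \<beta> < 0\<close>
    by (intro tendsto_add tendsto_mult tendsto_const) real_asymp+
  moreover have "2 * ((log 2 (real N) + 1)\<^sup>2 * real N powr (\<alpha> - \<beta>)) + real N powr (\<alpha> - 1) =
     real N powr (\<alpha> - 1) * (2 * (log 2 (real N) + 1)\<^sup>2 * real N powr (1 - \<beta>) + 1)" for N
  proof -
    have "real N powr (\<alpha> - \<beta>) = real N powr (\<alpha> - 1) * real N powr (1 - \<beta>)"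
      by (simp add: powr_add[symmetric])
    then show ?thesis by (simp add: algebra_simps)
  qed
  ultimately have "(\<lambda>N. real N powr (\<alpha> - 1) * (2 * (log 2 (real N) + 1)\<^sup>2 * real N powr (1 - \<beta>) + 1)) \<longlonglongrightarrow> 0"
    by simp
  then have "(\<lambda>N. R2 (clustered_vdc (mult_exp \<beta>)) \<alpha> s N - 2 * s) \<longlonglongrightarrow> 0"
    by (rule Lim_null_comparison[OF ev])
  then show ?thesis by (simp add: LIM_zero_iff)
qed

lemma has_PPC_clustered_vdc:
  assumes "0 < \<beta>" "\<beta> < 1" "0 \<le> \<alpha>" "\<alpha> < \<beta>"
  shows "has_PPC \<alpha> (clustered_vdc (mult_exp \<beta>))"
proof (cases "\<alpha> = 0")
  case True
  have "R2 (clustered_vdc (mult_exp \<beta>)) 0 s \<longlonglongrightarrow> 2 * s" if "0 < s" "s \<le> 1 / 2" for s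
    using assms that by (intro R2_clustered_vdc_tendsto eventually_mono[OF eventually_gt_at_top[of 0]]) auto
  then show ?thesis using True by (simp add: has_PPC_def)
next
  case False
  have "R2 (clustered_vdc (mult_exp \<beta>)) \<alpha> s \<longlonglongrightarrow> 2 * s" if "0 < s" for s
  proof (rule R2_clustered_vdc_tendsto)
    \<comment> \<open>For positive \<alpha> the radius tends to 0, so every \<open>s\<close> is
      eventually admissible.\<close>
    have "0 < \<alpha>" using False assms by simp
    then have "(\<lambda>N. s / real N powr \<alpha>) \<longlonglongrightarrow> 0" by real_asymp
    then have "\<forall>\<^sub>F N in sequentially. s / real N powr \<alpha> < 1 / 2" by (rule order_tendstoD) simp
    then show "\<forall>\<^sub>F N in sequentially. s / real N powr \<alpha> \<le> 1 / 2" by eventually_elim simp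
  qed (use assms that in auto)
  then show ?thesis using False by (simp add: has_PPC_def)
qed

section \<open>Failure from \<beta> on\<close>

lemma card_coincident_pairs_ge:
  assumes "p J \<le> J"
  shows "2 ^ J * (2 ^ p J - 1)
      \<le> card {(m, n). m \<in> {1..2 ^ Suc J} \<and> n \<in> {1..2 ^ Suc J} \<and> m \<noteq> n \<and>
                      clustered_vdc p m = clustered_vdc p n}" (is "_ \<le> card ?R")
proof -
  let ?M = "2 ^ p J :: nat"
  \<comment> \<open>The run containing \<open>m\<close>; it offers \<open>?M - 1\<close> partners
    for \<open>m\<close>.\<close>
  let ?B = "\<lambda>m. {m div ?M * ?M ..< m div ?M * ?M + ?M}"
  let ?T = "SIGMA m:{2 ^ J..<2 ^ Suc J}. ?B m - {m}"
  have "m \<in> ?B m" for m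
    using div_mult_mod_eq[of m ?M] mod_less_divisor[of ?M m] by (simp del: mod_less_divisor)
  then have card_T: "card ?T = 2 ^ J * (?M - 1)" by (simp add: card_SigmaI)
  have sub: "?T \<subseteq> ?R"
  proof (rule subsetI)
    fix x assume "x \<in> ?T"
    then obtain m n where x: "x = (m, n)" and m: "m \<in> {2 ^ J..<2 ^ Suc J}" and n: "n \<in> ?B m" "n \<noteq> m"
      by (elim SigmaE) simp
    have div: "n div ?M = m div ?M" using n by (intro div_nat_eqI) (auto simp: mult_ac)
    \<comment> \<open>Because \<open>p J \<le> J\<close>, both ends of the stage are multiples of
      the run length, so the run of \<open>m\<close> stays inside the stage.\<close>
    have M: "2 ^ J = 2 ^ (J - p J) * ?M" using assms by (simp flip: power_add)
    have "2 ^ (J - p J) \<le> m div ?M" "m div ?M < 2 ^ Suc (J - p J)"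
      using m unfolding atLeastLessThan_iff power_Suc M
      by (auto simp: less_eq_div_iff_mult_less_eq div_less_iff_less_mult)
    then have n': "2 ^ J \<le> n" "n < 2 ^ Suc J"
      unfolding div[symmetric] power_Suc M
      by (auto simp: less_eq_div_iff_mult_less_eq div_less_iff_less_mult)
    have "clustered_vdc p m = clustered_vdc p n" using clustered_vdc_stage m n' div by simp
    moreover have "(1::nat) \<le> 2 ^ J" by simp
    ultimately have "m \<in> {1..2 ^ Suc J} \<and> n \<in> {1..2 ^ Suc J} \<and> m \<noteq> n \<and>
        clustered_vdc p m = clustered_vdc p n"
      using m n' n(2) by auto
    then show "x \<in> ?R" unfolding x by simp
  qed
  have fin: "finite ?R"
    by (rule finite_subset[of _ "{1..2 ^ Suc J} \<times> {1..2 ^ Suc J}"]) auto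
  show ?thesis using card_mono[OF fin sub] unfolding card_T .
qed

lemma R2_clustered_vdc_ge:
  assumes \<beta>: "0 < \<beta>" "\<beta> < 1" "\<beta> \<le> \<alpha>" and s: "0 < s" and J: "1 / (1 - \<beta>) \<le> real J"
  shows "1 / 16 \<le> R2 (clustered_vdc (mult_exp \<beta>)) \<alpha> s (2 ^ Suc J)"
proof -
  let ?y = "clustered_vdc (mult_exp \<beta>)" and ?N = "2 ^ Suc J :: nat" and ?p = "mult_exp \<beta> J"
  let ?C = "card {(m, n). m \<in> {1..?N} \<and> n \<in> {1..?N} \<and> m \<noteq> n \<and> dist_int (?y m - ?y n) \<le> s / real ?N powr \<alpha>}"
  \<comment> \<open>The lower bound on \<open>J\<close> makes runs have length at least 2, whence
    \<open>2 ^ ?p - 1\<close> is at least half of \<open>2 ^ ?p\<close>.\<close>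
  have "1 \<le> (1 - \<beta>) * real J" using J \<beta> by (simp add: field_simps)
  then have p1: "1 \<le> ?p" unfolding mult_exp_def by linarith
  have "(1 - \<beta>) * real J \<le> real J" using \<beta> by (simp add: algebra_simps)
  then have pJ: "?p \<le> J" unfolding mult_exp_def by linarith
  have "2 ^ J * (2 ^ ?p - 1) \<le>
      card {(m, n). m \<in> {1..?N} \<and> n \<in> {1..?N} \<and> m \<noteq> n \<and> ?y m = ?y n}"
    using card_coincident_pairs_ge[where p = "mult_exp \<beta>", OF pJ] .
  also have "\<dots> \<le> ?C"
  proof (rule card_mono)
    show "finite {(m, n). m \<in> {1..?N} \<and> n \<in> {1..?N} \<and> m \<noteq> n \<and> dist_int (?y m - ?y n) \<le> s / real ?N powr \<alpha>}"
      by (rule finite_subset[of _ "{1..?N} \<times> {1..?N}"]) auto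
  qed (use s in \<open>auto simp: dist_int_def\<close>)
  finally have "real (2 ^ J * (2 ^ ?p - 1)) \<le> real ?C" by (simp only: of_nat_le_iff)
  moreover have "(2::real) \<le> 2 ^ ?p" using power_increasing[OF p1, of "2::real"] by simp
  ultimately have C: "2 ^ J * (2 ^ ?p / 2) \<le> real ?C"
    by (intro order_trans[OF mult_left_mono[of "2 ^ ?p / 2" "2 ^ ?p - 1"]]) (auto simp: of_nat_diff)
  have N: "real ?N powr (2 - \<alpha>) \<le> real ?N powr (2 - \<beta>)"
    using \<beta> one_le_power[of "2::real" "Suc J"] by (intro powr_mono) auto
  \<comment> \<open>The constant 16 is composed of 4 from \<open>2 powr (2 - \<beta>)\<close>, 2
    from the floor in \<open>mult_exp\<close>, and 2 from the halved run length.\<close>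
  have "real ?N powr (2 - \<beta>) = 2 powr (2 - \<beta>) * (2 ^ J) powr (1 + (1 - \<beta>))"
    by (simp add: powr_mult)
  also have "\<dots> \<le> 2 powr 2 * (2 ^ J) powr (1 + (1 - \<beta>))"
    using \<beta> by (intro mult_right_mono powr_mono) auto
  also have "\<dots> = 4 * (2 ^ J * (2 ^ J) powr (1 - \<beta>))" by (simp only: powr_add) simp
  also have "\<dots> \<le> 4 * (2 ^ J * (2 * 2 ^ ?p))"
    using two_power_mult_exp_ge[OF \<beta>(2)] by (intro mult_left_mono) auto
  also have "\<dots> \<le> 16 * real ?C" using C by simp
  finally have "real ?N powr (2 - \<alpha>) \<le> 16 * real ?C" using N by linarith
  moreover have "0 < real ?N powr (2 - \<alpha>)" by simp
  ultimately show ?thesis unfolding R2_def by (simp add: field_simps)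
qed

lemma not_has_PPC_clustered_vdc:
  assumes "0 < \<beta>" "\<beta> < 1" "\<beta> \<le> \<alpha>"
  shows "\<not> has_PPC \<alpha> (clustered_vdc (mult_exp \<beta>))"
proof
  \<comment> \<open>With \<open>s = 1 / 64\<close> the required limit is \<open>1 / 32\<close>,
    below the lower bound \<open>1 / 16\<close> that holds along powers of two.\<close>
  let ?R = "R2 (clustered_vdc (mult_exp \<beta>)) \<alpha> (1 / 64)"
  assume "has_PPC \<alpha> (clustered_vdc (mult_exp \<beta>))"
  then have "\<forall>s>0. R2 (clustered_vdc (mult_exp \<beta>)) \<alpha> s \<longlonglongrightarrow> 2 * s"
    using assms by (simp add: has_PPC_def)
  then have "?R \<longlonglongrightarrow> 2 * (1 / 64)" by (rule allE[of _ "1 / 64"]) simp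
  moreover have "strict_mono (\<lambda>J. 2 ^ Suc J :: nat)" by (simp add: strict_mono_def)
  ultimately have "(\<lambda>J. ?R (2 ^ Suc J)) \<longlonglongrightarrow> 2 * (1 / 64)"
    by (rule LIMSEQ_subseq_LIMSEQ[unfolded comp_def])
  moreover have "1 / 16 \<le> ?R (2 ^ Suc J)" if "nat \<lceil>1 / (1 - \<beta>)\<rceil> \<le> J" for J
    using assms that by (intro R2_clustered_vdc_ge) linarith+
  ultimately have "1 / 16 \<le> 2 * (1 / 64 :: real)" by (blast intro: LIMSEQ_le_const)
  then show False by simp
qed

theorem theorem5:
  fixes \<beta> :: real
  assumes "0 < \<beta>" and "\<beta> < 1"
  shows "\<exists>y :: nat \<Rightarrow> real.
           (\<forall>n\<ge>1. y n \<in> {0..1}) \<and>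
           (\<forall>\<alpha>. 0 \<le> \<alpha> \<and> \<alpha> < \<beta> \<longrightarrow> has_PPC \<alpha> y) \<and>
           (\<forall>\<alpha>. \<beta> \<le> \<alpha> \<and> \<alpha> \<le> 1 \<longrightarrow> \<not> has_PPC \<alpha> y)"
  using assms has_PPC_clustered_vdc not_has_PPC_clustered_vdc clustered_vdc_nonneg clustered_vdc_less_1
  by (intro exI[of _ "clustered_vdc (mult_exp \<beta>)"]) (auto intro: less_imp_le)

end
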